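(* For every real $r$ with $1\le r<\infty$, as $n\to\infty$, $$\int_0^1 |p_{2n}(x)|^r\,dx \sim \left(\frac{2}{(2\pi)^{2n}}\right)^r \int_0^1 |\cos(2\pi x)|^r\,dx,$$ $$\int_0^1 |p_{2n+1}(x)|^r\,dx \sim \left(\frac{2}{(2\pi)^{2n+1}}\right)^r \int_0^1 |\sin(2\pi x)|^r\,dx,$$ $$\int_0^1 |q_{2n}(x)|^r\,dx \sim \left(\frac{2}{(2\pi)^{2n}}\right)^r \int_0^1 |\cos(2\pi x)+1|^r\,dx.$$
   Context: The Bernoulli polynomials $B_n(x)$ are defined by $B_0(x)=1$ and, for $n\ge1$, $\frac{d}{dx}B_n(x)=nB_{n-1}(x)$ together with $\int_0^1 B_n(x)\,dx=0$; the Bernoulli numbers are $B_n=B_n(0)$. Put $p_n(x)=B_n(x)/n!$ and $q_n(x)=B_n(x)/n!-B_n/n!$. Here $u_n\sim v_n$ means $u_n/v_n\to1$ as $n\to\infty$. *)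

theory Defs
  imports
    "HOL-Analysis.Analysis"
    "HOL-Computational_Algebra.Polynomial"
    "HOL-Library.Landau_Symbols"
begin

unbundle asymp_equiv_syntax

primrec bernoulli_poly :: "nat \<Rightarrow> real poly" where
  "bernoulli_poly 0 = 1"
| "bernoulli_poly (Suc n) =
     (THE P. (\<forall>x. (poly P has_real_derivative real (Suc n) * poly (bernoulli_poly n) x) (at x))
           \<and> integral {0..1} (poly P) = 0)"

definition bernoulli_num :: "nat \<Rightarrow> real" where
  "bernoulli_num n = poly (bernoulli_poly n) 0"

definition bernoulli_p :: "nat \<Rightarrow> real \<Rightarrow> real" where
  "bernoulli_p n x = poly (bernoulli_poly n) x / fact n"

definition bernoulli_q :: "nat \<Rightarrow> real \<Rightarrow> real" where
  "bernoulli_q n x = poly (bernoulli_poly n) x / fact n - bernoulli_num n / fact n"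

text \<open>The definite description in the recursion is well defined.\<close>

lemma pderiv_surj:
  fixes f :: "real poly"
  shows "\<exists>P. pderiv P = f"
proof
  have sum_pderiv: "pderiv (sum g A) = (\<Sum>i\<in>A. pderiv (g i))"
    for g :: "nat \<Rightarrow> real poly" and A
    by (induction A rule: infinite_finite_induct) (simp_all add: pderiv_add)
  let ?P = "\<Sum>i\<le>degree f. monom (coeff f i / real (Suc i)) (Suc i)"
  have "pderiv ?P = (\<Sum>i\<le>degree f. monom (coeff f i) i)"
    by (subst sum_pderiv) (intro sum.cong refl, simp add: pderiv_monom del: of_nat_Suc)
  then show "pderiv ?P = f"
    by (simp add: poly_as_sum_of_monoms)
qed

lemma ex1_poly_antiderivative:
  fixes f :: "real poly"
  shows "\<exists>!P. (\<forall>x. (poly P has_real_derivative c * poly f x) (at x))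
            \<and> integral {0..1} (poly P) = 0"
proof -
  have deriv_iff: "(\<forall>x. (poly P has_real_derivative c * poly f x) (at x))
      \<longleftrightarrow> pderiv P = smult c f" for P
  proof
    assume *: "\<forall>x. (poly P has_real_derivative c * poly f x) (at x)"
    have "poly (pderiv P) x = poly (smult c f) x" for x
      using DERIV_unique[OF poly_DERIV *[rule_format, of x]] by simp
    then show "pderiv P = smult c f"
      using poly_eq_poly_eq_iff by blast
  next
    assume "pderiv P = smult c f"
    then show "\<forall>x. (poly P has_real_derivative c * poly f x) (at x)"
      using poly_DERIV[of P] by (metis poly_smult)
  qed
  have int: "poly P integrable_on {0..1}" for P :: "real poly"
    by (intro integrable_continuous_real continuous_intros)
  have shift: "integral {0..1} (poly (P + [:d:])) = integral {0..1} (poly P) + d"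
    for P :: "real poly" and d
  proof -
    have "integral {0..1} (\<lambda>x. poly P x + d) = integral {0..1} (poly P) + integral {0..1} (\<lambda>x::real. d)"
      by (rule integral_add) (use int in auto)
    moreover have "poly (P + [:d:]) = (\<lambda>x. poly P x + d)"
      by (simp add: fun_eq_iff)
    ultimately show ?thesis by simp
  qed
  obtain P where P: "pderiv P = smult c f"
    using pderiv_surj by blast
  show ?thesis
    unfolding deriv_iff
  proof (rule ex1I)
    show "pderiv (P + [:- integral {0..1} (poly P):]) = smult c f
        \<and> integral {0..1} (poly (P + [:- integral {0..1} (poly P):])) = 0"
      unfolding shift by (simp add: pderiv_add P pderiv_pCons)
  next
    fix Q assume Q: "pderiv Q = smult c f \<and> integral {0..1} (poly Q) = 0"
    have "pderiv (Q - P) = 0"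
      using P Q by (simp add: pderiv_diff)
    then obtain d where "Q - P = [:d:]"
      using pderiv_iszero by blast
    then have "Q = P + [:d:]"
      by (metis add.commute diff_add_cancel)
    moreover from this have "d = - integral {0..1} (poly P)"
      using Q shift[of P d] by simp
    ultimately show "Q = P + [:- integral {0..1} (poly P):]"
      by simp
  qed
qed

lemma bernoulli_poly_Suc:
  shows "(poly (bernoulli_poly (Suc n)) has_real_derivative
            real (Suc n) * poly (bernoulli_poly n) x) (at x)"
    and "integral {0..1} (poly (bernoulli_poly (Suc n))) = 0"
  using theI'[OF ex1_poly_antiderivative[of "real (Suc n)" "bernoulli_poly n"]]
  by simp_all

end

(* The Fourier series  B_n(x)/n! = -2/(2 pi)^n * sum_{k>=1} cos(2 pi k x - n pi/2)/k^n  on [0,1]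
   is dominated by its k = 1 term, up to O(2^-n) uniformly in x; dominated convergence then passes
   this to the integrals of r-th powers. The limit obtained for q_{2n} is |cos(2 pi x) - 1|, which has
   the same integral as |cos(2 pi x) + 1| by a shift of half a period.
   The series is proved first for n = 2, where Euler's value of zeta(2) fixes the constant and the
   derived series sum sin(2 pi k x)/k converges locally uniformly on (0,1); both sides satisfy the
   recursion defining the Bernoulli polynomials, which gives all n >= 2. *)

theory Submission
  imports Defs
begin

text \<open>The phase \<open>n * pi / 2\<close> turns termwise differentiation into lowering
  \<open>n\<close> by one, with the factor \<open>2 * pi\<close> and no alternation between sines
  and cosines.\<close>

definition zeta_cos :: "nat \<Rightarrow> real \<Rightarrow> real" where
  "zeta_cos n x = (\<Sum>k. cos (2 * pi * real (Suc k) * x - real n * pi / 2) / real (Suc k) ^ n)"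

section \<open>Uniform convergence of the sawtooth series away from 0 and 1\<close>

text \<open>Multiplied by \<open>sin (pi * x)\<close>, each cosine becomes a difference of two
  sines, and the sum telescopes.\<close>

lemma dirichlet_kernel:
  "sin (pi * x) * (1 + 2 * (\<Sum>k<N. cos (2 * pi * real (Suc k) * x))) = sin (real (2 * N + 1) * pi * x)"
proof (induction N)
  case (Suc N)
  have "sin (2 * pi * real (Suc N) * x + pi * x) - sin (2 * pi * real (Suc N) * x - pi * x)
      = 2 * (sin (pi * x) * cos (2 * pi * real (Suc N) * x))"
    unfolding sin_add sin_diff by simp
  moreover have "2 * pi * real (Suc N) * x + pi * x = real (2 * Suc N + 1) * pi * x"
      "2 * pi * real (Suc N) * x - pi * x = real (2 * N + 1) * pi * x"
    by (simp_all add: algebra_simps)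
  ultimately have "2 * (sin (pi * x) * cos (2 * pi * real (Suc N) * x))
      = sin (real (2 * Suc N + 1) * pi * x) - sin (real (2 * N + 1) * pi * x)"
    by simp
  with Suc show ?case
    by (simp add: distrib_left del: of_nat_Suc)
qed simp

text \<open>Integrating the Dirichlet kernel by parts once shows that the error is
  \<open>cos (M * pi * x) / (M * sin (pi * x))\<close> with \<open>M = 2 * N + 1\<close>, up to a term \<open>E\<close> whose
  derivative is \<open>O(1 / M)\<close>.\<close>

lemma sin_series_uniform_limit:
  assumes d: "0 < d" "d \<le> 1 / 2"
  shows "uniform_limit {d..1 - d} (\<lambda>N x. \<Sum>k<N. sin (2 * pi * real (Suc k) * x) / real (Suc k))
           (\<lambda>x. pi * (1 / 2 - x)) sequentially"
proof -
  \<comment> \<open>The positive minimum \<open>s\<close> of \<open>sin (pi * x)\<close> on the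
    compact interval makes all later bounds uniform in \<open>x\<close>.\<close>
  have "\<exists>y\<in>{d..1 - d}. \<forall>x\<in>{d..1 - d}. sin (pi * y) \<le> sin (pi * x)"
    by (rule continuous_attains_inf) (use d in \<open>auto intro!: continuous_intros\<close>)
  then obtain y where y: "y \<in> {d..1 - d}" and ymin: "\<And>x. x \<in> {d..1 - d} \<Longrightarrow> sin (pi * y) \<le> sin (pi * x)"
    by blast
  define s where "s = sin (pi * y)"
  have "s > 0"
    unfolding s_def using y d by (intro sin_gt_zero) auto
  have s: "s \<le> sin (pi * x)" if "x \<in> {d..1 - d}" for x
    using ymin[OF that] by (simp add: s_def)
  \<comment> \<open>The summand \<open>pi / s\<^sup>2\<close> comes from the bound on
    \<open>E'\<close>, the summand \<open>1 / s\<close> from the cosine quotient split off in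
    \<open>E\<close>.\<close>
  define C where "C = pi / s\<^sup>2 + 1 / s"
  let ?S = "\<lambda>N x. \<Sum>k<N. sin (2 * pi * real (Suc k) * x) / real (Suc k)"
  have bound: "\<bar>?S N x - pi * (1 / 2 - x)\<bar> \<le> C / real (2 * N + 1)" if x: "x \<in> {d..1 - d}" for N x
  proof -
    define M where "M = real (2 * N + 1)"
    have "M > 0"
      by (simp add: M_def)
    define E where "E x = pi * (1 / 2 - x) - ?S N x - cos (M * pi * x) / (M * sin (pi * x))" for x
    define E' where "E' x = pi * (cos (M * pi * x) * cos (pi * x)) / (M * (sin (pi * x))\<^sup>2)" for x
    have DE: "(E has_field_derivative E' x) (at x within {d..1 - d})" if "x \<in> {d..1 - d}" for x
    proof -
      have "sin (pi * x) > 0"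
        using s[OF that] \<open>s > 0\<close> by simp
      have "(?S N has_field_derivative (\<Sum>k<N. cos (2 * pi * real (Suc k) * x) * (2 * pi))) (at x within {d..1 - d})"
        by (rule DERIV_sum) (auto intro!: derivative_eq_intros simp del: of_nat_Suc)
      then have "(E has_field_derivative
          (- pi - (\<Sum>k<N. cos (2 * pi * real (Suc k) * x) * (2 * pi))
            - (- sin (M * pi * x) * (M * pi) * (M * sin (pi * x)) - cos (M * pi * x) * (cos (pi * x) * pi * M))
               / (M * sin (pi * x))\<^sup>2)) (at x within {d..1 - d})"
        unfolding E_def using \<open>sin (pi * x) > 0\<close> \<open>M > 0\<close>
        by (auto intro!: derivative_eq_intros simp: power2_eq_square simp del: of_nat_Suc)
      moreover have "- pi - (\<Sum>k<N. cos (2 * pi * real (Suc k) * x) * (2 * pi))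
          = - pi * (sin (M * pi * x) / sin (pi * x))"
      proof -
        have "- pi - (\<Sum>k<N. cos (2 * pi * real (Suc k) * x) * (2 * pi))
            = - pi * (1 + 2 * (\<Sum>k<N. cos (2 * pi * real (Suc k) * x)))"
          by (simp add: sum_distrib_left algebra_simps flip: sum_negf)
        also have "1 + 2 * (\<Sum>k<N. cos (2 * pi * real (Suc k) * x)) = sin (M * pi * x) / sin (pi * x)"
          using dirichlet_kernel[of x N] \<open>sin (pi * x) > 0\<close> by (simp add: M_def field_simps)
        finally show ?thesis .
      qed
      \<comment> \<open>The two sine quotients cancel; only a term with \<open>M\<close> in the
        denominator survives.\<close>
      moreover have "- pi * (sin (M * pi * x) / sin (pi * x))
            - (- sin (M * pi * x) * (M * pi) * (M * sin (pi * x)) - cos (M * pi * x) * (cos (pi * x) * pi * M))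
               / (M * sin (pi * x))\<^sup>2 = E' x"
        using \<open>sin (pi * x) > 0\<close> \<open>M > 0\<close> by (simp add: E'_def field_simps power2_eq_square)
      ultimately show ?thesis
        by simp
    qed
    have "norm (E' x) \<le> pi / (M * s\<^sup>2)" if "x \<in> {d..1 - d}" for x
    proof -
      have "\<bar>cos (M * pi * x) * cos (pi * x)\<bar> \<le> 1"
        unfolding abs_mult by (intro mult_le_one) auto
      moreover have "s\<^sup>2 \<le> (sin (pi * x))\<^sup>2"
        using s[OF that] \<open>s > 0\<close> by (intro power_mono) auto
      ultimately have "pi * \<bar>cos (M * pi * x) * cos (pi * x)\<bar> / (M * (sin (pi * x))\<^sup>2) \<le> pi * 1 / (M * s\<^sup>2)"
        using \<open>M > 0\<close> \<open>s > 0\<close> by (intro frac_le mult_left_mono) auto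
      then show ?thesis
        using \<open>M > 0\<close> by (simp add: E'_def abs_mult)
    qed
    then have "norm (E x - E (1 / 2)) \<le> pi / (M * s\<^sup>2) * norm (x - 1 / 2)"
      using x d by (intro field_differentiable_bound[OF _ DE]) auto
    also have "\<dots> \<le> pi / (M * s\<^sup>2) * 1"
      using x d \<open>M > 0\<close> by (intro mult_left_mono) (auto simp: abs_if)
    \<comment> \<open>At the midpoint the limit and every sine vanish, and so does the cosine
      because \<open>M\<close> is odd; the bound on \<open>E'\<close> therefore bounds
      \<open>E\<close> itself.\<close>
    also have "E (1 / 2) = 0"
    proof -
      have "sin (2 * pi * real (Suc k) * (1 / 2)) = 0" for k
        using sin_npi[of "Suc k"] by (simp add: mult.commute)
      moreover have "cos (M * pi * (1 / 2)) = 0"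
        by (simp add: M_def cos_add algebra_simps)
      ultimately show ?thesis
        unfolding E_def by simp
    qed
    finally have "\<bar>E x\<bar> \<le> pi / (M * s\<^sup>2)"
      by simp
    moreover have "\<bar>cos (M * pi * x) / (M * sin (pi * x))\<bar> \<le> 1 / (M * s)"
      unfolding abs_divide using s[OF x] \<open>s > 0\<close> \<open>M > 0\<close> by (intro frac_le) auto
    ultimately have "\<bar>?S N x - pi * (1 / 2 - x)\<bar> \<le> pi / (M * s\<^sup>2) + 1 / (M * s)"
      unfolding E_def by linarith
    also have "\<dots> = C / M"
      by (simp add: C_def add_divide_distrib mult.commute)
    finally show ?thesis
      by (simp add: M_def)
  qed
  have lim: "(\<lambda>N. C / real (2 * N + 1)) \<longlonglongrightarrow> 0"
    using LIMSEQ_subseq_LIMSEQ[OF lim_const_over_n, of "\<lambda>N. 2 * N + 1" C]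
    by (simp add: strict_mono_def o_def)
  show ?thesis
  proof (rule uniform_limitI)
    fix e :: real assume "e > 0"
    then have "eventually (\<lambda>N. C / real (2 * N + 1) < e) sequentially"
      using lim by (simp add: order_tendsto_iff)
    then show "\<forall>\<^sub>F N in sequentially. \<forall>x\<in>{d..1 - d}. dist (?S N x) (pi * (1 / 2 - x)) < e"
    proof eventually_elim
      case (elim N)
      then show ?case
        unfolding dist_real_def using bound le_less_trans by blast
    qed
  qed
qed

section \<open>Convergence, continuity and differentiation of the cosine series\<close>

text \<open>The majorant depends on neither \<open>n\<close> nor \<open>x\<close>, so one convergent
  series serves all indices from 2 on.\<close>

lemma zeta_cos_term_le:
  assumes "2 \<le> n"
  shows "norm (cos (2 * pi * real (Suc k) * x - real n * pi / 2) / real (Suc k) ^ n) \<le> 1 / (real k + 1)\<^sup>2"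
proof -
  have "(real k + 1)\<^sup>2 \<le> (real k + 1) ^ n"
    using assms by (intro power_increasing) auto
  then have "\<bar>cos (2 * pi * real (Suc k) * x - real n * pi / 2)\<bar> / (real k + 1) ^ n \<le> 1 / (real k + 1)\<^sup>2"
    by (intro frac_le) auto
  then show ?thesis
    by (simp add: add.commute)
qed

lemma inverse_squares_sums_real: "(\<lambda>k. 1 / (real k + 1)\<^sup>2) sums (pi\<^sup>2 / 6)"
  using inverse_squares_sums by (simp add: add.commute)

lemmas summable_inverse_squares_real = sums_summable[OF inverse_squares_sums_real]

lemma zeta_cos_uniform_limit:
  assumes "2 \<le> n"
  shows "uniform_limit A
    (\<lambda>N x. \<Sum>k<N. cos (2 * pi * real (Suc k) * x - real n * pi / 2) / real (Suc k) ^ n) (zeta_cos n) sequentially"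
  unfolding zeta_cos_def[abs_def]
  by (rule Weierstrass_m_test[OF zeta_cos_term_le[OF assms] summable_inverse_squares_real])

lemma zeta_cos_sums:
  assumes "2 \<le> n"
  shows "(\<lambda>k. cos (2 * pi * real (Suc k) * x - real n * pi / 2) / real (Suc k) ^ n) sums zeta_cos n x"
  unfolding zeta_cos_def
  by (intro summable_sums summable_comparison_test'[OF summable_inverse_squares_real] zeta_cos_term_le assms)

lemma continuous_on_zeta_cos:
  assumes "2 \<le> n"
  shows "continuous_on A (zeta_cos n)"
  by (rule uniform_limit_theorem[OF _ zeta_cos_uniform_limit[OF assms]])
     (auto intro!: always_eventually continuous_intros simp del: of_nat_Suc)

text \<open>A bound independent of \<open>n\<close> is what dominated convergence requires
  later.\<close>

lemma abs_zeta_cos_le: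
  assumes "2 \<le> n"
  shows "\<bar>zeta_cos n x\<bar> \<le> pi\<^sup>2 / 6"
proof -
  have "norm (zeta_cos n x) \<le> (\<Sum>k. 1 / (real k + 1)\<^sup>2)"
    unfolding zeta_cos_def
    by (rule norm_suminf_le[OF zeta_cos_term_le[OF assms] summable_inverse_squares_real])
  then show ?thesis
    using sums_unique[OF inverse_squares_sums_real] by simp
qed

text \<open>The differentiated series is \<open>2 * pi\<close> times the series of index
  \<open>n\<close>, which converges uniformly on the whole line for \<open>n\<close> at least 2;
  this justifies termwise differentiation.\<close>

lemma zeta_cos_deriv:
  assumes "2 \<le> n"
  shows "(zeta_cos (Suc n) has_real_derivative 2 * pi * zeta_cos n x) (at x)"
proof -
  let ?f = "\<lambda>n k x. cos (2 * pi * real (Suc k) * x - real n * pi / 2) / real (Suc k) ^ n"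
  have "(?f (Suc n) k has_real_derivative 2 * pi * ?f n k x) (at x within UNIV)" for k x
  proof -
    have "- sin (2 * pi * real (Suc k) * x - real (Suc n) * pi / 2) = cos (2 * pi * real (Suc k) * x - real n * pi / 2)"
    proof -
      have "2 * pi * real (Suc k) * x - real (Suc n) * pi / 2 = 2 * pi * real (Suc k) * x - real n * pi / 2 - pi / 2"
        by (simp add: field_simps)
      then show ?thesis
        by (simp only: sin_diff[of _ "pi / 2"]) simp
    qed
    then show ?thesis
      by (auto intro!: derivative_eq_intros simp del: of_nat_Suc)
  qed
  moreover have "uniform_limit UNIV (\<lambda>N x. \<Sum>k<N. 2 * pi * ?f n k x) (\<lambda>x. 2 * pi * zeta_cos n x) sequentially"
    unfolding sum_distrib_left[symmetric]
    \<comment> \<open>The indexed fact is used for multiplication by the constant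
      \<open>2 * pi\<close>, which preserves uniform limits.\<close>
    by (rule bounded_linear_uniform_limit_intros(13)[OF zeta_cos_uniform_limit[OF assms]])
  ultimately have "\<exists>g. \<forall>x\<in>UNIV. (\<lambda>k. ?f (Suc n) k x) sums g x \<and> (g has_real_derivative 2 * pi * zeta_cos n x) (at x within UNIV)"
    using sums_summable[OF zeta_cos_sums[of "Suc n" 0]] assms
    by (intro has_field_derivative_series[where ?x0.0 = 0]) auto
  then obtain g where g: "\<And>x. (\<lambda>k. ?f (Suc n) k x) sums g x" "\<And>x. (g has_real_derivative 2 * pi * zeta_cos n x) (at x)"
    by auto
  have "g = zeta_cos (Suc n)"
    using g(1) zeta_cos_sums[of "Suc n"] assms by (auto intro!: ext sums_unique2)
  with g(2) show ?thesis
    by blast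
qed


section \<open>Closed form of the series of index 2\<close>

text \<open>Here the differentiated series is the sawtooth series, for which uniform convergence is
  at hand only on \<open>{d..1 - d}\<close>; termwise differentiation is carried out there.\<close>

lemma zeta_cos_2_deriv:
  assumes "0 < x" "x < 1"
  shows "(zeta_cos 2 has_real_derivative pi\<^sup>2 * (1 - 2 * x)) (at x)"
proof -
  \<comment> \<open>Half the distance to the nearer endpoint puts \<open>x\<close> in the interior
    of \<open>{d..1 - d}\<close>, so the derivative within the interval is a full one.\<close>
  define d where "d = min x (1 - x) / 2"
  have d: "0 < d" "d \<le> 1 / 2" "d < x" "x < 1 - d"
    using assms by (auto simp: d_def min_def field_simps)
  let ?f = "\<lambda>k x. cos (2 * pi * real (Suc k) * x - real 2 * pi / 2) / real (Suc k) ^ 2"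
  let ?f' = "\<lambda>k x. 2 * pi * (sin (2 * pi * real (Suc k) * x) / real (Suc k))"
  have "(?f k has_real_derivative ?f' k x) (at x within {d..1 - d})" for k x
    by (auto intro!: derivative_eq_intros simp: power2_eq_square simp del: of_nat_Suc)
  moreover have "uniform_limit {d..1 - d} (\<lambda>N x. \<Sum>k<N. ?f' k x) (\<lambda>x. 2 * pi * (pi * (1 / 2 - x))) sequentially"
    unfolding sum_distrib_left[symmetric]
    by (rule bounded_linear_uniform_limit_intros(13)[OF sin_series_uniform_limit[OF d(1,2)]])
  moreover have "x \<in> {d..1 - d}"
    using d by auto
  ultimately have "\<exists>g. \<forall>y\<in>{d..1 - d}. (\<lambda>k. ?f k y) sums g y
      \<and> (g has_real_derivative 2 * pi * (pi * (1 / 2 - y))) (at y within {d..1 - d})"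
    using zeta_cos_sums[of 2, THEN sums_summable]
    by (intro has_field_derivative_series[where ?x0.0 = x]) auto
  then obtain g where g: "\<And>y. y \<in> {d..1 - d} \<Longrightarrow> (\<lambda>k. ?f k y) sums g y"
      "\<And>y. y \<in> {d..1 - d} \<Longrightarrow> (g has_real_derivative 2 * pi * (pi * (1 / 2 - y))) (at y within {d..1 - d})"
    by blast
  have eq: "g y = zeta_cos 2 y" if "y \<in> {d..1 - d}" for y
    using g(1)[OF that] zeta_cos_sums[of 2 y] by (simp add: sums_unique2)
  have "(g has_real_derivative 2 * pi * (pi * (1 / 2 - x))) (at x)"
    using g(2)[of x] d at_within_interior[of x "{d..1 - d}"] by simp
  then have "(zeta_cos 2 has_real_derivative 2 * pi * (pi * (1 / 2 - x))) (at x)"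
    by (rule has_field_derivative_transform_within_open[where S = "{d<..<1 - d}"]) (use d eq in auto)
  then show ?thesis
    by (simp add: power2_eq_square algebra_simps)
qed

text \<open>Both sides have the same derivative on (0,1) and are continuous on [0,1]; the constant
  is read off at 0, where every cosine is -1 and the series is minus Euler's sum.\<close>

lemma zeta_cos_2:
  assumes "x \<in> {0..1}"
  shows "zeta_cos 2 x = - pi\<^sup>2 * (x\<^sup>2 - x + 1 / 6)"
proof -
  define h where "h x = zeta_cos 2 x + pi\<^sup>2 * (x\<^sup>2 - x)" for x
  have "h x = h 0"
  proof (rule DERIV_isconst2[of 0 1])
    show "continuous_on {0..1} h"
      unfolding h_def[abs_def] by (intro continuous_intros continuous_on_zeta_cos) auto
    show "(h has_real_derivative 0) (at y)" if "0 < y" "y < 1" for y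
      unfolding h_def[abs_def]
      by (rule derivative_eq_intros zeta_cos_2_deriv that refl | simp add: algebra_simps)+
  qed (use assms in auto)
  moreover have "zeta_cos 2 0 = - (pi\<^sup>2 / 6)"
  proof -
    have "(\<lambda>k. - (1 / (real k + 1)\<^sup>2)) sums - (pi\<^sup>2 / 6)"
      by (rule sums_minus[OF inverse_squares_sums_real])
    moreover have "(\<lambda>k. - (1 / (real k + 1)\<^sup>2)) sums zeta_cos 2 0"
      using zeta_cos_sums[of 2 0] by (simp add: add.commute)
    ultimately show ?thesis
      by (simp add: sums_unique2)
  qed
  ultimately show ?thesis
    by (simp add: h_def algebra_simps)
qed

section \<open>Fourier series of the Bernoulli polynomials\<close>

text \<open>The series of the next index, divided by \<open>2 * pi\<close>, is an antiderivative,
  and it takes equal values at 0 and 1 by periodicity.\<close>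

lemma zeta_cos_has_integral:
  assumes "2 \<le> n"
  shows "(zeta_cos (Suc n) has_integral 0) {0..1}"
proof -
  have "(zeta_cos (Suc n) has_integral
      (zeta_cos (Suc (Suc n)) 1 / (2 * pi) - zeta_cos (Suc (Suc n)) 0 / (2 * pi))) {0..1}"
  proof (rule fundamental_theorem_of_calculus)
    fix x :: real
    have "((\<lambda>x. zeta_cos (Suc (Suc n)) x / (2 * pi)) has_real_derivative zeta_cos (Suc n) x) (at x)"
      using assms by (auto intro!: derivative_eq_intros zeta_cos_deriv)
    then show "((\<lambda>x. zeta_cos (Suc (Suc n)) x / (2 * pi)) has_vector_derivative zeta_cos (Suc n) x) (at x within {0..1})"
      by (simp add: has_real_derivative_iff_has_vector_derivative has_vector_derivative_at_within)
  qed simp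
  moreover have "zeta_cos m 1 = zeta_cos m 0" for m
  proof -
    have "cos (2 * pi * real (Suc k) * 1 - a) = cos (2 * pi * real (Suc k) * 0 - a)" for k a
      unfolding cos_diff
      using cos_2pi_minus sin_npi[of "2 * Suc k"] cos_npi[of "2 * Suc k"] by (simp add: ac_simps)
    then show ?thesis
      unfolding zeta_cos_def by presburger
  qed
  ultimately show ?thesis
    by simp
qed

lemma bernoulli_p_deriv:
  "(bernoulli_p (Suc n) has_real_derivative bernoulli_p n x) (at x)"
  unfolding bernoulli_p_def[abs_def]
  by (rule derivative_eq_intros bernoulli_poly_Suc refl | simp)+

lemma continuous_on_bernoulli_p: "continuous_on A (bernoulli_p n)"
  unfolding bernoulli_p_def[abs_def] by (intro continuous_intros) auto

text \<open>Equal derivatives on (0,1) and continuity make the difference constant on [0,1]; the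
  constant is its integral over the unit interval, hence 0.\<close>

lemma bernoulli_p_Suc_unique:
  assumes cont: "continuous_on {0..1} f"
    and deriv: "\<And>x. \<lbrakk>0 < x; x < 1\<rbrakk> \<Longrightarrow> (f has_real_derivative bernoulli_p n x) (at x)"
    and int: "(f has_integral 0) {0..1}"
    and x: "x \<in> {0..1}"
  shows "bernoulli_p (Suc n) x = f x"
proof -
  define g where "g x = bernoulli_p (Suc n) x - f x" for x
  have const: "g x = g 0" if "x \<in> {0..1}" for x
  proof (rule DERIV_isconst2[of 0 1])
    show "continuous_on {0..1} g"
      unfolding g_def[abs_def] by (intro continuous_intros continuous_on_bernoulli_p cont)
    show "(g has_real_derivative 0) (at y)" if "0 < y" "y < 1" for y
      unfolding g_def[abs_def]
      by (rule derivative_eq_intros bernoulli_p_deriv deriv that refl | simp)+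
  qed (use that in auto)
  have "(poly (bernoulli_poly (Suc n)) has_integral 0) {0..1}"
    using integrable_integral[of "poly (bernoulli_poly (Suc n))" "{0..1}"] bernoulli_poly_Suc(2)[of n]
    by (simp del: bernoulli_poly.simps add: integrable_continuous_real continuous_on_poly)
  from has_integral_divide[OF this, of "fact (Suc n)"]
  have "(bernoulli_p (Suc n) has_integral 0) {0..1}"
    by (simp add: bernoulli_p_def[abs_def])
  from has_integral_diff[OF this int]
  have "(g has_integral 0) {0..1}"
    by (simp add: g_def[abs_def])
  then have "((\<lambda>x. g 0) has_integral 0) {0..1::real}"
    using has_integral_cong[of "{0..1}" g "\<lambda>_. g 0" 0, OF const] by simp
  moreover have "((\<lambda>x. g 0) has_integral g 0) {0..1::real}"
    using has_integral_const_real[of "g 0" 0 1] by simp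
  ultimately have "g 0 = 0"
    by (rule has_integral_unique[symmetric])
  with const[OF x] show ?thesis
    by (simp add: g_def)
qed

text \<open>The series results start at index 2, so the first two polynomials are computed directly;
  the second is the base of the induction for the Fourier series.\<close>

lemma bernoulli_p_1:
  assumes "x \<in> {0..1}"
  shows "bernoulli_p 1 x = x - 1 / 2"
  unfolding One_nat_def
proof (rule bernoulli_p_Suc_unique)
  have "((\<lambda>x::real. x - 1 / 2) has_integral ((1\<^sup>2 / 2 - 1 / 2) - (0\<^sup>2 / 2 - 0 / 2))) {0..1}"
    by (rule fundamental_theorem_of_calculus)
       (auto intro!: derivative_eq_intros simp flip: has_real_derivative_iff_has_vector_derivative)
  then show "((\<lambda>x::real. x - 1 / 2) has_integral 0) {0..1}"
    by simp
qed (use assms in \<open>auto intro!: derivative_eq_intros continuous_intros simp: bernoulli_p_def\<close>)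

lemma bernoulli_p_2:
  assumes "x \<in> {0..1}"
  shows "bernoulli_p 2 x = (x\<^sup>2 - x + 1 / 6) / 2"
  unfolding numeral_2_eq_2
proof (rule bernoulli_p_Suc_unique)
  have "((\<lambda>x::real. (x ^ 2 - x + 1 / 6) / 2) has_integral ((1 ^ 3 / 6 - 1 ^ 2 / 4 + 1 / 12) - (0 ^ 3 / 6 - 0 ^ 2 / 4 + 0 / 12))) {0..1}"
    by (rule fundamental_theorem_of_calculus)
       (auto intro!: derivative_eq_intros simp: field_simps simp flip: has_real_derivative_iff_has_vector_derivative)
  then show "((\<lambda>x::real. (x ^ Suc (Suc 0) - x + 1 / 6) / 2) has_integral 0) {0..1}"
    by (simp add: power2_eq_square)
  show "((\<lambda>x::real. (x ^ Suc (Suc 0) - x + 1 / 6) / 2) has_real_derivative bernoulli_p (Suc 0) x) (at x)"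
    if "0 < x" "x < 1" for x
    using bernoulli_p_1[of x] that by (auto intro!: derivative_eq_intros simp: field_simps)
qed (use assms in \<open>auto intro!: continuous_intros\<close>)

text \<open>The power of \<open>2 * pi\<close> in the denominator absorbs the factor that each
  differentiation produces, so the right-hand side obeys the recursion for
  \<open>bernoulli_p\<close>.\<close>

proposition bernoulli_p_fourier:
  assumes "2 \<le> n" "x \<in> {0..1}"
  shows "bernoulli_p n x = - 2 / (2 * pi) ^ n * zeta_cos n x"
  using assms
proof (induction n arbitrary: x rule: dec_induct)
  case base
  then show ?case
    by (simp add: bernoulli_p_2 zeta_cos_2 power2_eq_square)
next
  case (step n)
  show ?case
  proof (rule bernoulli_p_Suc_unique)
    show "continuous_on {0..1} (\<lambda>x. - 2 / (2 * pi) ^ Suc n * zeta_cos (Suc n) x)"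
      using step by (intro continuous_intros continuous_on_zeta_cos) auto
    show "((\<lambda>x. - 2 / (2 * pi) ^ Suc n * zeta_cos (Suc n) x) has_real_derivative bernoulli_p n y) (at y)"
      if "0 < y" "y < 1" for y
      using step.IH[of y] DERIV_cmult[OF zeta_cos_deriv[OF step.hyps(1), of y], of "- 2 / (2 * pi) ^ Suc n"] that
      by simp
    show "((\<lambda>x. - 2 / (2 * pi) ^ Suc n * zeta_cos (Suc n) x) has_integral 0) {0..1}"
      using has_integral_mult_right[OF zeta_cos_has_integral[OF step.hyps(1)], of "- 2 / (2 * pi) ^ Suc n"]
      by simp
  qed (use step in auto)
qed

section \<open>Dominance of the first term\<close>

text \<open>In the tail all frequencies are at least 2: of the \<open>n\<close> factors in the
  denominator, \<open>n - 2\<close> give the geometric decay \<open>4 * (1 / 2) ^ n\<close>, and two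
  are kept for summability.\<close>

lemma zeta_cos_approx:
  assumes "2 \<le> n"
  shows "\<bar>zeta_cos n x - cos (2 * pi * x - real n * pi / 2)\<bar> \<le> 4 * (1 / 2) ^ n * (pi\<^sup>2 / 6)"
proof -
  let ?f = "\<lambda>k. cos (2 * pi * real (Suc k) * x - real n * pi / 2) / real (Suc k) ^ n"
  have "(\<lambda>k. ?f (Suc k)) sums (zeta_cos n x - ?f 0)"
    using zeta_cos_sums[OF assms, of x] by (subst sums_Suc_iff) simp
  then have "(\<lambda>k. ?f (Suc k)) sums (zeta_cos n x - cos (2 * pi * x - real n * pi / 2))"
    by simp
  moreover have major: "(\<lambda>k. 4 * (1 / 2) ^ n * (1 / (real k + 1)\<^sup>2)) sums (4 * (1 / 2) ^ n * (pi\<^sup>2 / 6))"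
    by (intro sums_mult inverse_squares_sums_real)
  moreover have "norm (?f (Suc k)) \<le> 4 * (1 / 2) ^ n * (1 / (real k + 1)\<^sup>2)" for k
  proof -
    obtain m where n: "n = m + 2"
      using assms by (metis add.commute le_Suc_ex)
    have "2 ^ m * (real k + 1)\<^sup>2 \<le> real (Suc (Suc k)) ^ m * real (Suc (Suc k)) ^ 2"
      by (intro mult_mono power_mono) auto
    then have "norm (?f (Suc k)) \<le> 1 / (2 ^ m * (real k + 1)\<^sup>2)"
      unfolding n real_norm_def power_add abs_divide
      by (intro frac_le) auto
    then show ?thesis
      by (simp add: n power_divide)
  qed
  ultimately show ?thesis
    using norm_suminf_le[of "\<lambda>k. ?f (Suc k)" "\<lambda>k. 4 * (1 / 2) ^ n * (1 / (real k + 1)\<^sup>2)"]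
    by (simp add: sums_iff)
qed

text \<open>The sign \<open>(- 1) ^ n\<close> cancels the part \<open>n * pi\<close> of the phase.
  The cases \<open>j = 0\<close> and \<open>j = 1\<close> yield the cosine and the sine.\<close>

lemma zeta_cos_tendsto:
  "(\<lambda>n. (- 1) ^ n * zeta_cos (2 * n + j) x) \<longlonglongrightarrow> cos (2 * pi * x - real j * pi / 2)"
proof (rule LIM_zero_cancel, rule Lim_null_comparison)
  show "(\<lambda>n. 4 * (1 / 2) ^ n * (pi\<^sup>2 / 6)) \<longlonglongrightarrow> 0"
    by (auto intro!: tendsto_mult_left_zero tendsto_mult_right_zero LIMSEQ_power_zero)
  show "\<forall>\<^sub>F n in sequentially.
      norm ((- 1) ^ n * zeta_cos (2 * n + j) x - cos (2 * pi * x - real j * pi / 2)) \<le> 4 * (1 / 2) ^ n * (pi\<^sup>2 / 6)"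
    using eventually_ge_at_top[of 1]
  proof eventually_elim
    case (elim n)
    have "2 * pi * x - real (2 * n + j) * pi / 2 = (2 * pi * x - real j * pi / 2) - real n * pi"
      by (simp add: field_simps)
    then have "cos (2 * pi * x - real (2 * n + j) * pi / 2) = (- 1) ^ n * cos (2 * pi * x - real j * pi / 2)"
      by (simp only: cos_diff[of "2 * pi * x - real j * pi / 2"] cos_npi sin_npi) simp
    then have "(- 1) ^ n * zeta_cos (2 * n + j) x - cos (2 * pi * x - real j * pi / 2)
        = (- 1) ^ n * (zeta_cos (2 * n + j) x - cos (2 * pi * x - real (2 * n + j) * pi / 2))"
      by (simp add: right_diff_distrib flip: power_add mult.assoc power_mult_distrib)
    then have "norm ((- 1) ^ n * zeta_cos (2 * n + j) x - cos (2 * pi * x - real j * pi / 2))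
        = \<bar>zeta_cos (2 * n + j) x - cos (2 * pi * x - real (2 * n + j) * pi / 2)\<bar>"
      by (simp add: abs_mult power_abs)
    also have "\<dots> \<le> 4 * (1 / 2) ^ (2 * n + j) * (pi\<^sup>2 / 6)"
      using elim by (intro zeta_cos_approx) auto
    also have "\<dots> \<le> 4 * (1 / 2) ^ n * (pi\<^sup>2 / 6)"
      by (intro mult_right_mono mult_left_mono power_decreasing) auto
    finally show ?case .
  qed
qed

section \<open>From pointwise limits to integrals of powers\<close>

text \<open>\<open>f n\<close> is \<open>h n\<close> rescaled by \<open>c n\<close> up to sign.
  Dominated convergence gives the limit of the rescaled integrals; the point \<open>a\<close> makes
  that limit nonzero, which turns convergence into asymptotic equivalence.\<close>

lemma integral_powr_asymp_equiv:
  fixes f h :: "nat \<Rightarrow> real \<Rightarrow> real" and g :: "real \<Rightarrow> real"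
  assumes "0 < r"
    and contf: "\<And>n. 0 < n \<Longrightarrow> continuous_on {0..1} (f n)"
    and bound: "\<And>n x. \<lbrakk>0 < n; x \<in> {0..1}\<rbrakk> \<Longrightarrow> \<bar>f n x\<bar> \<le> M"
    and lim: "\<And>x. x \<in> {0..1} \<Longrightarrow> (\<lambda>n. f n x) \<longlonglongrightarrow> g x"
    and contg: "continuous_on {0..1} g"
    and "a \<in> {0..1}" "g a \<noteq> 0"
    and c: "\<And>n. 0 < c n"
    and h: "\<And>n x. \<lbrakk>0 < n; x \<in> {0..1}\<rbrakk> \<Longrightarrow> \<bar>h n x\<bar> = c n * \<bar>f n x\<bar>"
  shows "(\<lambda>n. integral {0..1} (\<lambda>x. \<bar>h n x\<bar> powr r)) \<sim>[sequentially]
         (\<lambda>n. c n powr r * integral {0..1} (\<lambda>x. \<bar>g x\<bar> powr r))"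
proof -
  let ?I = "\<lambda>f. integral {0..1} (\<lambda>x. \<bar>f x\<bar> powr r)"
  have cont_powr: "continuous_on {0..1} (\<lambda>x. \<bar>f x\<bar> powr r)" if "continuous_on {0..1} f" for f :: "real \<Rightarrow> real"
    using that \<open>0 < r\<close> by (intro continuous_on_powr' continuous_intros) auto
  \<comment> \<open>The shift to \<open>Suc n\<close> skips index 0, for which nothing is assumed
    about \<open>f\<close>.\<close>
  have "(\<lambda>n. ?I (f (Suc n))) \<longlonglongrightarrow> ?I g"
  proof (rule dominated_convergence(2))
    show "(\<lambda>x. \<bar>f (Suc n) x\<bar> powr r) integrable_on {0..1}" for n
      by (intro integrable_continuous_real cont_powr contf) simp
    show "(\<lambda>x::real. M powr r) integrable_on {0..1}"
      by (rule integrable_const_ivl)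
    show "norm (\<bar>f (Suc n) x\<bar> powr r) \<le> M powr r" if "x \<in> {0..1}" for n x
      using bound[OF _ that] \<open>0 < r\<close> by (auto intro!: powr_mono2)
    show "(\<lambda>n. \<bar>f (Suc n) x\<bar> powr r) \<longlonglongrightarrow> \<bar>g x\<bar> powr r" if "x \<in> {0..1}" for x
      using LIMSEQ_Suc[OF lim[OF that]] \<open>0 < r\<close>
      by (intro tendsto_powr' tendsto_intros) auto
  qed
  then have "(\<lambda>n. ?I (f n)) \<longlonglongrightarrow> ?I g"
    by (rule LIMSEQ_imp_Suc)
  moreover have "eventually (\<lambda>n. ?I (f n) = ?I (h n) / c n powr r) sequentially"
    using eventually_gt_at_top[of 0]
  proof eventually_elim
    case (elim n)
    have "?I (h n) = integral {0..1} (\<lambda>x. c n powr r * \<bar>f n x\<bar> powr r)"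
      using h[OF elim] c[of n] by (intro integral_cong) (simp add: powr_mult)
    then show ?case
      using c[of n] by simp
  qed
  ultimately have "(\<lambda>n. ?I (h n) / c n powr r) \<longlonglongrightarrow> ?I g"
    by (simp cong: tendsto_cong)
  \<comment> \<open>A nonnegative continuous integrand that is positive at \<open>a\<close> has
    nonzero integral.\<close>
  moreover have "?I g \<noteq> 0"
    using integral_eq_0_iff[OF cont_powr[OF contg]] \<open>a \<in> {0..1}\<close> \<open>g a \<noteq> 0\<close> by auto
  ultimately show ?thesis
    using asymp_equivI'_const[of "\<lambda>n. ?I (h n)" "\<lambda>n. c n powr r" "?I g" sequentially]
    by (simp add: mult.commute)
qed

text \<open>Moving the argument by 1/2 negates the cosine, while the integral of a function of
  period 1 over a full period is unaffected by the shift.\<close>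

lemma integral_cos_half_period_shift:
  fixes F :: "real \<Rightarrow> real"
  assumes "continuous_on {-1..1} F"
  shows "integral {0..1} (\<lambda>x. F (cos (2 * pi * x))) = integral {0..1} (\<lambda>x. F (- cos (2 * pi * x)))"
proof -
  define G where "G x = F (cos (2 * pi * x))" for x
  have cont: "continuous_on A G" for A
    unfolding G_def by (intro continuous_on_compose2[OF assms] continuous_intros) auto
  have int: "G integrable_on {a..b}" for a b
    by (intro integrable_continuous_real cont)
  have shift: "integral {a..b} (\<lambda>x. G (x + c)) = integral {a + c..b + c} G" for a b c
    using has_integral_shift_cbox_iff[of G c "integral {a + c..b + c} G" a b] int
    by (simp add: o_def add.commute integral_unique integrable_integral)
  have per: "G (x + 1) = G x" for x
    by (simp add: G_def distrib_left)
  have anti: "G (x + 1 / 2) = F (- cos (2 * pi * x))" for x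
    by (simp add: G_def distrib_left)
  have "integral {0..1} (\<lambda>x. G (x + 1 / 2)) = integral {1 / 2..3 / 2} G"
    using shift[of 0 1 "1 / 2"] by simp
  also have "\<dots> = integral {1 / 2..1} G + integral {1..3 / 2} G"
    using int by (simp add: Henstock_Kurzweil_Integration.integral_combine)
  \<comment> \<open>The part beyond 1 is moved back by a full period to fill the gap left at the
    start.\<close>
  also have "integral {1..3 / 2} G = integral {0..1 / 2} G"
    using shift[of 0 "1 / 2" 1] by (simp add: per)
  also have "integral {1 / 2..1} G + integral {0..1 / 2} G = integral {0..1} G"
    using int by (simp add: Henstock_Kurzweil_Integration.integral_combine add.commute)
  finally show ?thesis
    unfolding anti unfolding G_def by (rule sym)
qed

section \<open>The three asymptotic formulas\<close>

theorem mainTheorem7: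
  fixes r :: real
  assumes "1 \<le> r"
  shows "((\<lambda>n::nat. integral {0..1} (\<lambda>x::real. \<bar>bernoulli_p (2 * n) x\<bar> powr r))
            \<sim>[sequentially]
          (\<lambda>n. (2 / (2 * pi) ^ (2 * n)) powr r
                 * integral {0..1} (\<lambda>x::real. \<bar>cos (2 * pi * x)\<bar> powr r)))
       \<and> ((\<lambda>n::nat. integral {0..1} (\<lambda>x::real. \<bar>bernoulli_p (2 * n + 1) x\<bar> powr r))
            \<sim>[sequentially]
          (\<lambda>n. (2 / (2 * pi) ^ (2 * n + 1)) powr r
                 * integral {0..1} (\<lambda>x::real. \<bar>sin (2 * pi * x)\<bar> powr r)))
       \<and> ((\<lambda>n::nat. integral {0..1} (\<lambda>x::real. \<bar>bernoulli_q (2 * n) x\<bar> powr r))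
            \<sim>[sequentially]
          (\<lambda>n. (2 / (2 * pi) ^ (2 * n)) powr r
                 * integral {0..1} (\<lambda>x::real. \<bar>cos (2 * pi * x) + 1\<bar> powr r)))"
proof (intro conjI)
  have "0 < r"
    using assms by simp
  \<comment> \<open>Inside the absolute value the minus sign of the Fourier factor disappears, and
    \<open>(- 1) ^ n\<close> can be inserted to obtain a convergent sequence.\<close>
  have abs_p: "\<bar>bernoulli_p (2 * n + j) x\<bar> = 2 / (2 * pi) ^ (2 * n + j) * \<bar>(- 1) ^ n * zeta_cos (2 * n + j) x\<bar>"
    if "0 < n" "x \<in> {0..1}" for n j x
    using bernoulli_p_fourier[of "2 * n + j" x] that by (simp add: abs_mult power_abs)
  have bound: "\<bar>(- 1) ^ n * zeta_cos (2 * n + j) x\<bar> \<le> pi\<^sup>2 / 6" if "0 < n" for n j x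
    using abs_zeta_cos_le[of "2 * n + j" x] that by (simp add: abs_mult power_abs)
  have cont: "continuous_on A (\<lambda>x. (- 1) ^ n * zeta_cos (2 * n + j) x)" if "0 < n" for A n j
    using that by (intro continuous_intros continuous_on_zeta_cos) auto
  show "(\<lambda>n::nat. integral {0..1} (\<lambda>x::real. \<bar>bernoulli_p (2 * n) x\<bar> powr r)) \<sim>[sequentially]
      (\<lambda>n. (2 / (2 * pi) ^ (2 * n)) powr r * integral {0..1} (\<lambda>x::real. \<bar>cos (2 * pi * x)\<bar> powr r))"
    by (rule integral_powr_asymp_equiv[where f = "\<lambda>n x. (- 1) ^ n * zeta_cos (2 * n) x" and a = 0 and M = "pi\<^sup>2 / 6"])
       (use \<open>0 < r\<close> cont[of _ _ 0] bound[of _ 0] abs_p[of _ _ 0] zeta_cos_tendsto[of 0]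
         in \<open>auto intro!: continuous_intros\<close>)
  have sin: "cos (2 * pi * x - real 1 * pi / 2) = sin (2 * pi * x)" for x
    by (simp add: cos_diff)
  show "(\<lambda>n::nat. integral {0..1} (\<lambda>x::real. \<bar>bernoulli_p (2 * n + 1) x\<bar> powr r)) \<sim>[sequentially]
      (\<lambda>n. (2 / (2 * pi) ^ (2 * n + 1)) powr r * integral {0..1} (\<lambda>x::real. \<bar>sin (2 * pi * x)\<bar> powr r))"
  proof (rule integral_powr_asymp_equiv[where f = "\<lambda>n x. (- 1) ^ n * zeta_cos (2 * n + 1) x" and a = "1 / 4" and M = "pi\<^sup>2 / 6"])
    show "(\<lambda>n. (- 1) ^ n * zeta_cos (2 * n + 1) x) \<longlonglongrightarrow> sin (2 * pi * x)" for x
      using zeta_cos_tendsto[of 1 x] unfolding sin .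
    have "2 * pi * (1 / 4) = pi / 2"
      by simp
    then show "sin (2 * pi * (1 / 4)) \<noteq> 0"
      by (simp only: sin_pi_half)
  qed (use \<open>0 < r\<close> cont[of _ _ 1] bound[of _ 1] abs_p[of _ _ 1] in \<open>auto intro!: continuous_intros\<close>)
  \<comment> \<open>Subtracting the value at 0 gives the limit \<open>cos (2 * pi * x) - 1\<close>,
    equal to -2 at the witness 1/2; the bound is twice that for a single series.\<close>
  have "(\<lambda>n::nat. integral {0..1} (\<lambda>x::real. \<bar>bernoulli_q (2 * n) x\<bar> powr r)) \<sim>[sequentially]
      (\<lambda>n. (2 / (2 * pi) ^ (2 * n)) powr r * integral {0..1} (\<lambda>x::real. \<bar>cos (2 * pi * x) - 1\<bar> powr r))"
  proof (rule integral_powr_asymp_equiv[where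
        f = "\<lambda>n x. (- 1) ^ n * zeta_cos (2 * n) x - (- 1) ^ n * zeta_cos (2 * n) 0" and a = "1 / 2" and M = "pi\<^sup>2 / 3"])
    show "\<bar>(- 1) ^ n * zeta_cos (2 * n) x - (- 1) ^ n * zeta_cos (2 * n) 0\<bar> \<le> pi\<^sup>2 / 3" if "0 < n" for n x
      using bound[OF that, of 0 x] bound[OF that, of 0 0] unfolding add_0_right by linarith
    show "(\<lambda>n. (- 1) ^ n * zeta_cos (2 * n) x - (- 1) ^ n * zeta_cos (2 * n) 0) \<longlonglongrightarrow> cos (2 * pi * x) - 1" for x
      using tendsto_diff[OF zeta_cos_tendsto[of 0 x] zeta_cos_tendsto[of 0 0]] by simp
    show "\<bar>bernoulli_q (2 * n) x\<bar>
        = 2 / (2 * pi) ^ (2 * n) * \<bar>(- 1) ^ n * zeta_cos (2 * n) x - (- 1) ^ n * zeta_cos (2 * n) 0\<bar>"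
      if "0 < n" "x \<in> {0..1}" for n x
    proof -
      have "bernoulli_q (2 * n) x = bernoulli_p (2 * n) x - bernoulli_p (2 * n) 0"
        by (simp add: bernoulli_q_def bernoulli_p_def bernoulli_num_def)
      also have "\<dots> = - (2 / (2 * pi) ^ (2 * n)) * (zeta_cos (2 * n) x - zeta_cos (2 * n) 0)"
        using bernoulli_p_fourier[of "2 * n"] that by (simp add: right_diff_distrib)
      finally have "\<bar>bernoulli_q (2 * n) x\<bar> = 2 / (2 * pi) ^ (2 * n) * \<bar>zeta_cos (2 * n) x - zeta_cos (2 * n) 0\<bar>"
        by (simp only: abs_mult) simp
      also have "\<bar>zeta_cos (2 * n) x - zeta_cos (2 * n) 0\<bar>
          = \<bar>(- 1) ^ n * zeta_cos (2 * n) x - (- 1) ^ n * zeta_cos (2 * n) 0\<bar>"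
        unfolding right_diff_distrib[symmetric] abs_mult power_abs by simp
      finally show ?thesis .
    qed
  qed (use \<open>0 < r\<close> in \<open>auto intro!: continuous_intros continuous_on_zeta_cos\<close>)
  \<comment> \<open>The half-period shift is applied with \<open>F t\<close> equal to
    \<open>\<bar>t - 1\<bar> powr r\<close>.\<close>
  also have "integral {0..1} (\<lambda>x::real. \<bar>cos (2 * pi * x) - 1\<bar> powr r)
      = integral {0..1} (\<lambda>x::real. \<bar>- cos (2 * pi * x) - 1\<bar> powr r)"
    using \<open>0 < r\<close> by (intro integral_cos_half_period_shift continuous_on_powr' continuous_intros) auto
  also have "(\<lambda>x::real. \<bar>- cos (2 * pi * x) - 1\<bar>) = (\<lambda>x. \<bar>cos (2 * pi * x) + 1\<bar>)"
    by (auto simp: abs_if)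
  finally show "(\<lambda>n::nat. integral {0..1} (\<lambda>x::real. \<bar>bernoulli_q (2 * n) x\<bar> powr r)) \<sim>[sequentially]
      (\<lambda>n. (2 / (2 * pi) ^ (2 * n)) powr r * integral {0..1} (\<lambda>x::real. \<bar>cos (2 * pi * x) + 1\<bar> powr r))" .
qed

end
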